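(* Let $A$ be a (commutative) algebra over $\mathbb C$ and let $y,T\in A[x]$. (1) If the equation $\mathrm{Wr}(y,\tilde y)=T$ has a solution $\tilde y\in A[x]$, then $y$ divides $\mathrm{Wr}(y',T)$ in $A[x]$. (2) If the ideal $(y,y')$ equals $A[x]$ and $y$ divides $\mathrm{Wr}(y',T)$, then the equation $\mathrm{Wr}(y,\tilde y)=T$ has a solution $\tilde y\in A[x]$.
   Context: $\mathrm{Wr}(f,g)=fg'-f'g$ for $f,g\in A[x]$, where $'$ is differentiation with respect to $x$ (the opposite sign convention gives an equivalent statement). $(y,y')$ is the ideal of $A[x]$ generated by $y$ and $y'$. *)

theory Defs
  imports Complex_Main "HOL-Computational_Algebra.Polynomial"
begin

text \<open>
  Commutative unital \<open>\<complex>\<close>-algebras. The class is built on \<^class>\<open>comm_ring\<close> and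
  \<^class>\<open>comm_monoid_mult\<close> rather than on \<^class>\<open>comm_ring_1\<close>, because the latter demands
  \<open>0 \<noteq> 1\<close> and would exclude the zero algebra.
\<close>

class comm_complex_algebra = comm_ring + comm_monoid_mult +
  fixes scaleC :: "complex \<Rightarrow> 'a \<Rightarrow> 'a"
  assumes scaleC_add_right: "scaleC c (a + b) = scaleC c a + scaleC c b"
    and scaleC_add_left: "scaleC (c + d) a = scaleC c a + scaleC d a"
    and scaleC_scaleC: "scaleC c (scaleC d a) = scaleC (c * d) a"
    and scaleC_one: "scaleC 1 a = a"
    and mult_scaleC_left: "scaleC c a * b = scaleC c (a * b)"
begin

lemma scaleC_zero_right [simp]: "scaleC c 0 = 0"
  using scaleC_add_right[of c 0 0] by simp

lemma scaleC_zero_left [simp]: "scaleC 0 a = 0"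
  using scaleC_add_left[of 0 0 a] by simp

end

instantiation complex :: comm_complex_algebra
begin

definition scaleC_complex :: "complex \<Rightarrow> complex \<Rightarrow> complex"
  where "scaleC_complex c a = c * a"

instance
  by standard (simp_all add: scaleC_complex_def algebra_simps)

end

text \<open>
  The library attaches \<open>dvd\<close> to \<open>'a poly\<close> only when \<open>'a\<close> has \<open>0 \<noteq> 1\<close>; its
  definition needs nothing but multiplication.
\<close>

instance poly :: (comm_semiring_0) Rings.dvd ..

text \<open>
  \<^const>\<open>pderiv\<close> is only available for coefficients without zero divisors, hence this
  version. The integer factor \<open>n + 1\<close> is taken in \<open>\<complex>\<close>.
\<close>

lift_definition poly_deriv :: "'a::comm_complex_algebra poly \<Rightarrow> 'a poly"
  is "\<lambda>p n. scaleC (of_nat (Suc n)) (p (Suc n))"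
proof -
  fix p :: "nat \<Rightarrow> 'a"
  assume "\<forall>\<^sub>\<infinity>n. p n = 0"
  then have "\<forall>\<^sub>\<infinity>n. p (Suc n) = 0"
    by (rule MOST_SucI)
  then show "\<forall>\<^sub>\<infinity>n. scaleC (of_nat (Suc n)) (p (Suc n)) = 0"
    by (rule MOST_mono) simp
qed

lemma coeff_poly_deriv: "coeff (poly_deriv p) n = scaleC (of_nat (Suc n)) (coeff p (Suc n))"
  by transfer rule

lemma scaleC_of_nat:
  "scaleC (of_nat n) (a :: 'a::{comm_complex_algebra,comm_semiring_1}) = of_nat n * a"
  by (induction n) (simp_all add: scaleC_add_left scaleC_one distrib_right)

lemma poly_deriv_eq_pderiv:
  "poly_deriv (p :: 'a::{comm_complex_algebra,idom} poly) = pderiv p"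
  by (rule poly_eqI) (simp only: coeff_poly_deriv coeff_pderiv scaleC_of_nat)

definition Wr :: "'a::comm_complex_algebra poly \<Rightarrow> 'a poly \<Rightarrow> 'a poly"
  where "Wr f g = f * poly_deriv g - poly_deriv f * g"

definition is_ideal :: "'a::comm_ring set \<Rightarrow> bool"
  where "is_ideal I \<longleftrightarrow> 0 \<in> I \<and> (\<forall>a\<in>I. \<forall>b\<in>I. a + b \<in> I) \<and> (\<forall>r. \<forall>a\<in>I. r * a \<in> I)"

definition ideal_gen :: "'a::comm_ring set \<Rightarrow> 'a set"
  where "ideal_gen S = is_ideal hull S"

end

theory Submission
  imports Defs
begin

text \<open>
  If \<open>T = y z' - y' z\<close> then \<open>T' = y z'' - y'' z\<close>, and \<open>y\<close> factors out of \<open>y' T' - y'' T\<close>.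
  Conversely, let \<open>a y + b y' = 1\<close> and \<open>y' T' - y'' T = y h\<close>. For \<open>z = y u - b T\<close> the equation
  follows from \<open>y u' = X\<close> with \<open>X = (a + b') T + b T'\<close>. Differentiating the Bezout
  identity shows that \<open>y\<close> divides \<open>y' X\<close>, hence it divides
  \<open>X = a y X + b (y' X)\<close>; finally the quotient has an antiderivative since positive integers are
  invertible in a \<open>\<complex>\<close>-algebra.
\<close>

lemma poly_deriv_0 [simp]: "poly_deriv 0 = 0"
  by (rule poly_eqI) (simp add: coeff_poly_deriv)

lemma poly_deriv_add: "poly_deriv (p + q) = poly_deriv p + poly_deriv q"
  by (rule poly_eqI) (simp add: coeff_poly_deriv scaleC_add_right)

lemma poly_deriv_minus: "poly_deriv (- p) = - poly_deriv p"
  using poly_deriv_add[of "- p" p] by (simp add: eq_neg_iff_add_eq_0)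

lemma poly_deriv_diff: "poly_deriv (p - q) = poly_deriv p - poly_deriv q"
  using poly_deriv_add[of p "- q"] by (simp add: poly_deriv_minus)

lemma poly_deriv_smult: "poly_deriv (smult c p) = smult c (poly_deriv p)"
  by (rule poly_eqI)
    (simp add: coeff_poly_deriv mult.commute[of c] mult_scaleC_left del: of_nat_Suc)

text \<open>The Leibniz rule for a + x p, which drives the induction behind the general product
  rule.\<close>

lemma poly_deriv_pCons: "poly_deriv (pCons a p) = p + pCons 0 (poly_deriv p)"
proof (rule poly_eqI)
  fix n
  have "scaleC (of_nat (Suc n)) (coeff p n) = coeff p n + scaleC (of_nat n) (coeff p n)"
    by (simp add: scaleC_add_left scaleC_one)
  then show "coeff (poly_deriv (pCons a p)) n = coeff (p + pCons 0 (poly_deriv p)) n"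
    by (cases n) (simp_all add: coeff_poly_deriv del: of_nat_Suc)
qed

lemma poly_deriv_mult: "poly_deriv (p * q) = poly_deriv p * q + p * poly_deriv q"
  by (induction p)
    (simp_all add: mult_pCons_left poly_deriv_add poly_deriv_smult poly_deriv_pCons algebra_simps)

lemma poly_deriv_surj:
  obtains u :: "'a::comm_complex_algebra poly" where "poly_deriv u = p"
proof -
  \<comment> \<open>At n = 0 both \<open>1 / 0 = 0\<close> and the truncated \<open>n - 1\<close>
    intervene, so the constant term is 0.\<close>
  define f where "f n = scaleC (1 / of_nat n) (coeff p (n - 1))" for n
  have "\<forall>\<^sub>\<infinity>n. f n = 0"
    unfolding MOST_nat
    by (intro exI[of _ "Suc (degree p)"]) (auto simp: f_def coeff_eq_0)
  then have "coeff (Abs_poly f) = f"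
    by (simp add: Abs_poly_inverse)
  moreover have "of_nat (Suc n) * (1 / of_nat (Suc n)) = (1 :: complex)" for n
    by (simp del: of_nat_Suc)
  ultimately have "poly_deriv (Abs_poly f) = p"
    by (intro poly_eqI)
      (simp add: coeff_poly_deriv f_def scaleC_scaleC scaleC_one del: of_nat_Suc times_divide_eq_right)
  then show thesis ..
qed

text \<open>
  The type \<open>'a poly\<close> has no unit constant here, because \<open>0 = 1\<close> is possible in \<open>'a\<close>; the
  constant polynomial \<open>[:1:]\<close> takes its place.
\<close>

lemma smult_one_id [simp]: "smult 1 p = (p :: 'a::comm_complex_algebra poly)"
  by (rule poly_eqI) simp

lemma one_poly_mult: "[:1:] * p = (p :: 'a::comm_complex_algebra poly)"
  by simp

lemma poly_deriv_one [simp]: "poly_deriv [:1:] = 0"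
  by (simp add: poly_deriv_pCons)

text \<open>The combinations of p and q form an ideal containing both, so the hull cannot be
  larger.\<close>

lemma ideal_gen_pair_bezout:
  fixes p q :: "'a::comm_complex_algebra poly"
  assumes "r \<in> ideal_gen {p, q}"
  obtains a b where "a * p + b * q = r"
proof -
  let ?I = "{a * p + b * q |a b. True}"
  have "is_ideal ?I"
    unfolding is_ideal_def
  proof (intro conjI ballI allI)
    show "0 \<in> ?I"
      by (auto intro!: exI[of _ 0])
  next
    fix f g assume "f \<in> ?I" "g \<in> ?I"
    then obtain a b c d where "f = a * p + b * q" "g = c * p + d * q"
      by blast
    then have "f + g = (a + c) * p + (b + d) * q"
      by (simp add: algebra_simps)
    then show "f + g \<in> ?I" by blast
  next
    fix s f assume "f \<in> ?I"
    then obtain a b where "f = a * p + b * q"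
      by blast
    then have "s * f = (s * a) * p + (s * b) * q"
      by (simp add: algebra_simps)
    then show "s * f \<in> ?I" by blast
  qed
  moreover have "p = [:1:] * p + 0 * q" "q = 0 * p + [:1:] * q"
    by simp_all
  then have "{p, q} \<subseteq> ?I" by blast
  ultimately have "ideal_gen {p, q} \<subseteq> ?I"
    unfolding ideal_gen_def by (intro hull_minimal)
  with assms that show thesis by blast
qed

lemma dvd_Wr_deriv_Wr:
  fixes y z :: "'a::comm_complex_algebra poly"
  shows "y dvd Wr (poly_deriv y) (Wr y z)"
proof (rule dvdI)
  \<comment> \<open>The two terms y' y'' z cancel, and every remaining term has a factor y.\<close>
  show "Wr (poly_deriv y) (Wr y z) = y * Wr (poly_deriv y) (poly_deriv z)"
    by (simp add: Wr_def poly_deriv_diff poly_deriv_mult algebra_simps)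
qed

lemma Wr_solvable:
  fixes y T :: "'a::comm_complex_algebra poly"
  assumes bezout: "a * y + b * poly_deriv y = [:1:]"
    and dvd: "y dvd Wr (poly_deriv y) T"
  obtains z where "Wr y z = T"
proof -
  let ?D = "poly_deriv :: 'a poly \<Rightarrow> 'a poly"
  from dvd obtain h where h: "?D y * ?D T - ?D (?D y) * T = y * h"
    unfolding Wr_def by (rule dvdE)
  have one: "p = a * y * p + b * ?D y * p" for p
    using bezout by (metis distrib_right one_poly_mult)
  have D_bezout: "?D a * y + a * ?D y + ?D b * ?D y + b * ?D (?D y) = 0"
    using arg_cong[OF bezout, of ?D] by (simp add: poly_deriv_add poly_deriv_mult add.assoc)
  \<comment> \<open>Replacing b y' by 1 - a y in the Wronskian of y and y u - b T gives T + y (y u'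
    - X).\<close>
  define X where "X = (a + ?D b) * T + b * ?D T"
  \<comment> \<open>Adding and subtracting a' y T and b y'' T exposes the differentiated Bezout
    identity and the left side of \<open>h\<close>.\<close>
  have "?D y * X = (?D a * y + a * ?D y + ?D b * ?D y + b * ?D (?D y)) * T
      - ?D a * y * T + b * (?D y * ?D T - ?D (?D y) * T)"
    by (simp add: X_def algebra_simps)
  also have "\<dots> = y * (b * h - ?D a * T)"
    unfolding D_bezout h by (simp add: algebra_simps)
  finally have y_dvd: "?D y * X = y * (b * h - ?D a * T)" .
  have "X = y * (a * X) + b * (?D y * X)"
    using one[of X] by (simp add: mult_ac)
  also have "\<dots> = y * (a * X + b * (b * h - ?D a * T))"
    unfolding y_dvd by (simp add: algebra_simps)
  finally have "X = y * (a * X + b * (b * h - ?D a * T))" .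
  then obtain u where u: "y * ?D u = X"
    using poly_deriv_surj by metis
  have "Wr y (y * u - b * T) = y * (y * ?D u) - y * X + (a * y * T + b * ?D y * T)"
    by (simp add: Wr_def X_def poly_deriv_diff poly_deriv_mult algebra_simps)
  also have "\<dots> = T"
    using u one[of T] by simp
  finally show thesis by (rule that)
qed

theorem lemmaA1:
  fixes y T :: "'a::comm_complex_algebra poly"
  shows "((\<exists>z. Wr y z = T) \<longrightarrow> y dvd Wr (poly_deriv y) T) \<and>
         (ideal_gen {y, poly_deriv y} = UNIV \<and> y dvd Wr (poly_deriv y) T \<longrightarrow>
           (\<exists>z. Wr y z = T))"
proof (intro conjI impI)
  assume "\<exists>z. Wr y z = T"
  then show "y dvd Wr (poly_deriv y) T"
    using dvd_Wr_deriv_Wr by blast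
next
  assume asm: "ideal_gen {y, poly_deriv y} = UNIV \<and> y dvd Wr (poly_deriv y) T"
  then obtain a b where "a * y + b * poly_deriv y = [:1:]"
    using ideal_gen_pair_bezout[of "[:1:]" y "poly_deriv y"] by auto
  with asm show "\<exists>z. Wr y z = T"
    by (meson Wr_solvable)
qed

end
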